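(* Let $H>0$ and let $B\in(0,\infty)\setminus\{1\}$. Then the spacelike surface of revolution in $\mathbb E_1^3$ with spacelike axis of revolution (the $x$-axis) and constant mean curvature $H$, $$S(s,\theta)=(x(s),\;z(s)\sinh\theta,\;z(s)\cosh\theta),\qquad s\in I,\ \theta\in\mathbb R,$$ whose generating curve is $$x(s)=\int_0^s\frac{B\cosh 2Ht-1}{\sqrt{1+B^2-2B\cosh 2Ht}}\,dt,\qquad z(s)=\frac{1}{2H}\sqrt{1+B^2-2B\cosh 2Hs},$$ is not algebraic. (The exceptional surfaces in the family, the spacelike cylinder and the standard hyperboloid, are attached to the excluded parameter values $B=0$ and $B=1$ respectively.)
   Context: $\mathbb E_1^3$ denotes Lorentz-Minkowski space $(\mathbb R^3,\,dx^2+dy^2-dz^2)$. Here $I$ is the open interval $\{s\in\mathbb R: 1+B^2-2B\cosh 2Hs>0\}$, which contains $0$ since $B\neq 1$. The generating curve $(x(s),0,z(s))$ is spacelike and parametrized by arc length, i.e. $x'(s)^2-z'(s)^2=1$. The surfaces with $0<B<1$ are called spacelike unduloids and those with $B>1$ spacelike nodoids (with spacelike axis). A surface in $\mathbb R^3$ is called algebraic if it is given by the vanishing of a polynomial. For parametrized pieces of surfaces this means: there is a nonzero polynomial $P\in\mathbb R[x,y,z]$ such that the surface is contained in (is part of) the zero set $P^{-1}(0)=\{(x,y,z)\in\mathbb R^3: P(x,y,z)=0\}$. *)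

theory Defs
  imports "HOL-Analysis.Analysis" "HOL-Computational_Algebra.Polynomial"
begin

text \<open>
  The ring of real polynomials in three variables \<open>x\<close>, \<open>y\<close>, \<open>z\<close> is represented by iterated
  univariate polynomials: the innermost variable is \<open>x\<close>, the middle one \<open>y\<close> and the
  outermost one \<open>z\<close>.
\<close>

type_synonym poly3 = "real poly poly poly"

definition eval3 :: "poly3 \<Rightarrow> real ^ 3 \<Rightarrow> real" where
  "eval3 P p = poly (poly (poly P [:[:p $ 3:]:]) [:p $ 2:]) (p $ 1)"

text \<open>
  A parametrized piece of surface is identified with its image; it is only required to be part
  of the zero set.
\<close>

definition algebraic_surface :: "(real ^ 3) set \<Rightarrow> bool" where
  "algebraic_surface S \<longleftrightarrow> (\<exists>P :: poly3. P \<noteq> 0 \<and> S \<subseteq> {p. eval3 P p = 0})"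

definition param_interval :: "real \<Rightarrow> real \<Rightarrow> real set" where
  "param_interval H B = {s. 1 + B\<^sup>2 - 2 * B * cosh (2 * H * s) > 0}"

text \<open>The integral is oriented, so that negative \<open>s\<close> is covered.\<close>

definition profile_x :: "real \<Rightarrow> real \<Rightarrow> real \<Rightarrow> real" where
  "profile_x H B s =
     (LBINT t=ereal 0..ereal s.
        (B * cosh (2 * H * t) - 1) / sqrt (1 + B\<^sup>2 - 2 * B * cosh (2 * H * t)))"

definition profile_z :: "real \<Rightarrow> real \<Rightarrow> real \<Rightarrow> real" where
  "profile_z H B s = 1 / (2 * H) * sqrt (1 + B\<^sup>2 - 2 * B * cosh (2 * H * s))"

text \<open>
  The curve \<open>(x(s), 0, z(s))\<close> is moved by the boosts \<open>(x, y, z) \<mapsto> (x, y cosh \<theta> + z sinh \<theta>,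
  y sinh \<theta> + z cosh \<theta>)\<close>, the rotations of \<open>dx\<^sup>2 + dy\<^sup>2 - dz\<^sup>2\<close> about the spacelike \<open>x\<close>-axis.
\<close>

definition revolution_param :: "real \<Rightarrow> real \<Rightarrow> real \<Rightarrow> real \<Rightarrow> real ^ 3" where
  "revolution_param H B s \<theta> =
     vector [profile_x H B s, profile_z H B s * sinh \<theta>, profile_z H B s * cosh \<theta>]"

definition cmc_revolution_surface :: "real \<Rightarrow> real \<Rightarrow> (real ^ 3) set" where
  "cmc_revolution_surface H B = {revolution_param H B s \<theta> | s \<theta>. s \<in> param_interval H B}"

end

theory Submission
  imports Defs "HOL-Complex_Analysis.Conformal_Mappings"
begin

text \<open>
  The coordinate \<open>z\<^sup>2\<close> is a polynomial in \<open>cosh 2Hs\<close> and so has the imaginary period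
  \<open>i\<pi>/H\<close>, whereas the elliptic integral \<open>x\<close>, continued to complex \<open>s\<close>, picks up a nonzero
  constant \<open>T\<close> along this period. An algebraic relation between the two would survive analytic
  continuation, so above one and the same value of \<open>z\<close> it would be satisfied by the infinitely
  many values \<open>x + nT\<close>; hence it is trivial.

  The continuation is carried out on the strip of complex \<open>s\<close> with real part in the parameter
  interval. There the radicand has positive real part (lemma \<open>Re_radicand_pos\<close>), so the principal
  square root is holomorphic, and convexity of the strip gives a single-valued primitive that
  extends \<open>x\<close> (lemma \<open>profile_x_extends_to_strip\<close>).

  That \<open>T \<noteq> 0\<close> is the heart of the matter (lemma \<open>profile_primitive_quasiperiodic\<close>). On the
  imaginary axis the integrand is \<open>(B cos u - 1) / sqrt (1 + B\<^sup>2 - 2 B cos u)\<close> with \<open>u = 2Ht\<close>,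
  up to the factor \<open>i\<close> the one for the Delaunay surfaces of Euclidean space. For \<open>B > 1\<close> it changes
  sign, but its values at \<open>u\<close> and \<open>u + \<pi>\<close> have a negative sum unless
  \<open>u\<close> is a multiple of \<open>\<pi>\<close>
  (lemma \<open>antipodal_profile_dx_sum_neg\<close>), which treats unduloids and nodoids alike.

  To get rid of the third variable, the surface is cut by the planes of constant \<open>y\<close>. The section
  is the curve \<open>(x(s), y, sqrt (z(s)\<^sup>2 + y\<^sup>2))\<close>, whose last coordinate is again
  \<open>i\<pi>/H\<close>-periodic, so that the argument applies to each section separately.
\<close>

section \<open>The generating curve at complex parameters\<close>

definition radicand :: "real \<Rightarrow> real \<Rightarrow> complex \<Rightarrow> complex" where
  "radicand H B w = 1 + (of_real B)\<^sup>2 - 2 * of_real B * cosh (2 * of_real H * w)"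

definition profile_strip :: "real \<Rightarrow> real \<Rightarrow> complex set" where
  "profile_strip H B = {w. Re w \<in> param_interval H B}"

text \<open>
  The integrand \<open>x'\<close>, continued to complex parameters; on the strip the principal
  root is the holomorphic continuation of the positive one.
\<close>

definition profile_dx :: "real \<Rightarrow> real \<Rightarrow> complex \<Rightarrow> complex" where
  "profile_dx H B w = (of_real B * cosh (2 * of_real H * w) - 1) / csqrt (radicand H B w)"

lemma cosh_of_real_complex: "cosh (complex_of_real x) = of_real (cosh x)"
  by (simp add: cosh_field_def exp_of_real flip: of_real_minus)

lemma Re_cosh: "Re (cosh w) = cosh (Re w) * cos (Im w)"
  by (simp add: cosh_field_def Re_exp field_simps)

lemma radicand_of_real:
  "radicand H B (of_real s) = of_real (1 + B\<^sup>2 - 2 * B * cosh (2 * H * s))"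
  using cosh_of_real_complex[of "2 * H * s"] by (simp add: radicand_def)

lemma cosh_period:
  assumes "H \<noteq> 0"
  shows "cosh (2 * of_real H * (w + of_nat n * (\<i> * of_real (pi / H)))) = cosh (2 * of_real H * w)"
proof -
  have "2 * of_real H * (w + of_nat n * (\<i> * of_real (pi / H)))
      = 2 * of_real H * w + of_nat n * (2 * of_real pi * \<i>)"
    using assms by (simp add: field_simps)
  moreover have "exp (of_nat n * (2 * of_real pi * \<i>)) = 1"
    by (simp add: exp_of_nat_mult exp_two_pi_i mult.commute)
  ultimately have "exp (2 * of_real H * (w + of_nat n * (\<i> * of_real (pi / H))))
      = exp (2 * of_real H * w)"
    by (simp only: exp_add) simp
  then show ?thesis
    by (simp only: cosh_def exp_minus)
qed

text \<open>
  Convexity of the interval passes to the strip, where it provides primitives and connectedness.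
\<close>

lemma convex_param_interval:
  assumes "B > 0"
  shows "convex (param_interval H B)"
proof -
  have "is_interval (param_interval H B)"
    unfolding is_interval_1
  proof (intro ballI allI impI)
    fix a b x assume a: "a \<in> param_interval H B" and b: "b \<in> param_interval H B"
      and x: "a \<le> x \<and> x \<le> b"
    have "\<bar>x\<bar> \<le> \<bar>a\<bar> \<or> \<bar>x\<bar> \<le> \<bar>b\<bar>" using x by linarith
    then have "\<bar>2 * H * x\<bar> \<le> \<bar>2 * H * a\<bar> \<or> \<bar>2 * H * x\<bar> \<le> \<bar>2 * H * b\<bar>"
      by (auto simp: abs_mult intro: mult_left_mono)
    then have "cosh (2 * H * x) \<le> cosh (2 * H * a) \<or> cosh (2 * H * x) \<le> cosh (2 * H * b)"
      by (metis abs_ge_zero cosh_real_abs cosh_real_nonneg_le_iff)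
    then have "B * cosh (2 * H * x) \<le> B * cosh (2 * H * a) \<or> B * cosh (2 * H * x) \<le> B * cosh (2 * H * b)"
      using assms by (auto intro: mult_left_mono)
    then show "x \<in> param_interval H B"
      using a b by (auto simp: param_interval_def)
  qed
  then show ?thesis by (simp add: is_interval_convex_1)
qed

lemma open_param_interval: "open (param_interval H B)"
  unfolding param_interval_def by (intro open_Collect_less continuous_intros)

lemma zero_in_param_interval:
  assumes "B \<noteq> 1"
  shows "0 \<in> param_interval H B"
proof -
  have "0 < (B - 1)\<^sup>2" using assms by simp
  then show ?thesis by (simp add: param_interval_def power2_eq_square algebra_simps)
qed

lemma open_profile_strip: "open (profile_strip H B)"
proof -
  have "profile_strip H B = Re -` param_interval H B"
    by (auto simp: profile_strip_def)
  then show ?thesis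
    using open_vimage[OF open_param_interval] continuous_on_Re[OF continuous_on_id] by (metis id_apply continuous_on_cong)
qed

lemma convex_profile_strip:
  assumes "B > 0"
  shows "convex (profile_strip H B)"
proof -
  have "profile_strip H B = Re -` param_interval H B"
    by (auto simp: profile_strip_def)
  then show ?thesis
    using convex_linear_vimage[OF bounded_linear.linear[OF bounded_linear_Re] convex_param_interval[OF assms]]
    by simp
qed

text \<open>
  Since \<open>Re (cosh (a + ib)) = cosh a cos b \<le> cosh a\<close>, moving off the real axis can only increase
  the real part of the radicand; this is why the whole strip above the parameter interval
  stays clear of the branch cut.
\<close>

lemma Re_radicand_pos:
  assumes "B > 0" "w \<in> profile_strip H B"
  shows "Re (radicand H B w) > 0"
proof -
  have "Re (cosh (2 * of_real H * w)) \<le> cosh (2 * H * Re w)"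
    using mult_left_mono[OF cos_le_one, of "cosh (2 * H * Re w)" "2 * H * Im w"]
    by (simp add: Re_cosh)
  then have "B * Re (cosh (2 * of_real H * w)) \<le> B * cosh (2 * H * Re w)"
    using assms by simp
  moreover have "Re (radicand H B w) = 1 + B\<^sup>2 - 2 * (B * Re (cosh (2 * of_real H * w)))"
    unfolding radicand_def by (simp add: power2_eq_square)
  ultimately show ?thesis
    using assms(2) by (simp add: profile_strip_def param_interval_def)
qed

lemma cosh_scaled_holomorphic: "(\<lambda>w. cosh (2 * complex_of_real H * w)) holomorphic_on A"
  unfolding cosh_field_def by (intro holomorphic_intros) auto

lemma radicand_holomorphic: "radicand H B holomorphic_on A"
  unfolding radicand_def by (intro holomorphic_intros cosh_scaled_holomorphic)

lemma csqrt_of_real_pos: "x > 0 \<Longrightarrow> csqrt (of_real x) = of_real (sqrt x)"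
  by simp

lemma not_nonpos_Reals_if_Re_pos: "Re z > 0 \<Longrightarrow> z \<notin> \<real>\<^sub>\<le>\<^sub>0"
  by (auto simp: complex_nonpos_Reals_iff)

lemma profile_dx_holomorphic:
  assumes "B > 0"
  shows "profile_dx H B holomorphic_on profile_strip H B"
proof -
  have pos: "radicand H B w \<notin> \<real>\<^sub>\<le>\<^sub>0" if "w \<in> profile_strip H B" for w
    using Re_radicand_pos[OF assms that] by (rule not_nonpos_Reals_if_Re_pos)
  then have "csqrt (radicand H B w) \<noteq> 0" if "w \<in> profile_strip H B" for w
    using that by fastforce
  with pos show ?thesis
    unfolding profile_dx_def
    by (intro holomorphic_intros cosh_scaled_holomorphic radicand_holomorphic)
qed

lemma profile_dx_of_real:
  assumes "s \<in> param_interval H B"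
  shows "profile_dx H B (of_real s) =
    of_real ((B * cosh (2 * H * s) - 1) / sqrt (1 + B\<^sup>2 - 2 * B * cosh (2 * H * s)))"
proof -
  have "csqrt (radicand H B (of_real s)) = of_real (sqrt (1 + B\<^sup>2 - 2 * B * cosh (2 * H * s)))"
    unfolding radicand_of_real using assms by (intro csqrt_of_real_pos) (simp add: param_interval_def)
  then show ?thesis
    using cosh_of_real_complex[of "2 * H * s"] by (simp add: profile_dx_def)
qed

text \<open>
  On the imaginary axis the integrand is real, so its primitive grows in the imaginary direction
  only, and the period can be studied by real calculus.
\<close>

lemma profile_dx_imaginary:
  assumes "B > 0" "B \<noteq> 1"
  shows "profile_dx H B (\<i> * of_real t) =
    of_real ((B * cos (2 * H * t) - 1) / sqrt (1 + B\<^sup>2 - 2 * B * cos (2 * H * t)))"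
proof -
  have c: "cosh (2 * of_real H * (\<i> * of_real t)) = complex_of_real (cos (2 * H * t))"
    using cos_conv_cosh[of "of_real (2 * H * t)"] by (simp add: cos_of_real[symmetric] ac_simps)
  have r: "radicand H B (\<i> * of_real t) = of_real (1 + B\<^sup>2 - 2 * B * cos (2 * H * t))"
    unfolding radicand_def c by simp
  have "\<i> * of_real t \<in> profile_strip H B"
    using zero_in_param_interval[OF assms(2)] by (simp add: profile_strip_def)
  then have "0 < 1 + B\<^sup>2 - 2 * B * cos (2 * H * t)"
    using Re_radicand_pos[OF assms(1)] r by (metis Re_complex_of_real)
  from csqrt_of_real_pos[OF this] show ?thesis
    unfolding profile_dx_def c r by (simp only: of_real_divide of_real_diff of_real_mult of_real_1)
qed

section \<open>The imaginary period of the elliptic integral\<close>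

text \<open>
  Here \<open>c\<close> stands for \<open>cos u\<close>, and \<open>- c\<close> for the cosine of the antipodal angle. By symmetry
  let \<open>0 \<le> c\<close>. After clearing denominators the claim compares \<open>Bc - 1\<close> and \<open>Bc + 1\<close>, weighted
  by roots; the only case that is not a matter of signs is \<open>Bc > 1\<close>, where squaring reduces it to
  the positivity of \<open>4 B\<^sup>3 c (1 - c\<^sup>2)\<close>.
\<close>

lemma antipodal_profile_dx_sum_neg:
  fixes B c :: real
  assumes "B > 0" "B \<noteq> 1" "\<bar>c\<bar> < 1"
  shows "(B * c - 1) / sqrt (1 + B\<^sup>2 - 2 * B * c)
       + (B * (- c) - 1) / sqrt (1 + B\<^sup>2 - 2 * B * (- c)) < 0"
proof -
  have pos: "0 < 1 + B\<^sup>2 - 2 * B * u" if "\<bar>u\<bar> < 1" for u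
  proof -
    have "2 * B * u < 2 * B * 1" using assms that by (intro mult_strict_left_mono) auto
    moreover have "0 \<le> (B - 1)\<^sup>2" by simp
    ultimately show ?thesis by (simp add: power2_eq_square algebra_simps)
  qed
  have key: "(B * u - 1) / sqrt (1 + B\<^sup>2 - 2 * B * u)
       + (B * (- u) - 1) / sqrt (1 + B\<^sup>2 - 2 * B * (- u)) < 0" if u: "0 \<le> u" "u < 1" for u
  proof -
    define D where "D = 1 + B\<^sup>2 - 2 * B * u"
    define E where "E = 1 + B\<^sup>2 - 2 * B * (- u)"
    have D: "D > 0" and E: "E > 0" using pos[of u] pos[of "-u"] u by (auto simp: D_def E_def)
    have "(B * u - 1) * sqrt E < (B * u + 1) * sqrt D"
    proof (cases "B * u \<le> 1")
      case True
      have "(B * u - 1) * sqrt E \<le> 0" using True E by (simp add: mult_nonpos_nonneg)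
      also have "0 < (B * u + 1) * sqrt D" using D assms u by (simp add: add_nonneg_pos)
      finally show ?thesis .
    next
      case False
      then have "u \<noteq> 0" by auto
      then have up: "u > 0" using u by simp
      have "(B * u + 1)\<^sup>2 * D - (B * u - 1)\<^sup>2 * E = 4 * (B * u) * (B\<^sup>2 * (1 - u\<^sup>2))"
        unfolding D_def E_def by algebra
      moreover have "u\<^sup>2 < 1" using u by (simp add: power_less_one_iff abs_square_less_1)
      then have "0 < 4 * (B * u) * (B\<^sup>2 * (1 - u\<^sup>2))" using assms up by simp
      ultimately have "((B * u - 1) * sqrt E)\<^sup>2 < ((B * u + 1) * sqrt D)\<^sup>2"
        using D E by (simp add: power_mult_distrib)
      then show ?thesis
        by (rule power2_less_imp_less) (use False D in auto)
    qed
    then have "(B * u - 1) / sqrt D < (B * u + 1) / sqrt E"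
      using D E by (simp add: divide_simps mult.commute)
    moreover have "B * (- u) - 1 = - (B * u + 1)" by simp
    ultimately have "(B * u - 1) / sqrt D + (B * (- u) - 1) / sqrt E < 0"
      by (simp only: minus_divide_left[symmetric])
    then show ?thesis by (simp only: D_def E_def)
  qed
  show ?thesis
    using key[of c] key[of "-c"] assms by (cases "c \<ge> 0") (auto simp: add.commute)
qed

text \<open>
  The primitive exists because the strip is convex; on the real axis it is the oriented integral
  by the fundamental theorem of calculus.
\<close>

lemma profile_x_extends_to_strip:
  assumes "B > 0" "B \<noteq> 1"
  obtains F where "\<And>w. w \<in> profile_strip H B \<Longrightarrow> (F has_field_derivative profile_dx H B w) (at w)"
    and "\<And>s. s \<in> param_interval H B \<Longrightarrow> F (of_real s) = of_real (profile_x H B s)"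
proof -
  let ?W = "profile_strip H B"
  obtain G where G: "\<And>w. w \<in> ?W \<Longrightarrow> (G has_field_derivative profile_dx H B w) (at w within ?W)"
    using holomorphic_convex_primitive'[OF convex_profile_strip[OF assms(1)] open_profile_strip
        profile_dx_holomorphic[OF assms(1), of H]] by blast
  have G': "(G has_field_derivative profile_dx H B w) (at w)" if "w \<in> ?W" for w
    using G[OF that] at_within_open[OF that open_profile_strip] by simp
  define F where "F = (\<lambda>w. G w - G 0)"
  have F: "(F has_field_derivative profile_dx H B w) (at w)" if "w \<in> ?W" for w
    unfolding F_def using G'[OF that] by (auto intro!: derivative_eq_intros)
  have "F (of_real s) = of_real (profile_x H B s)" if s: "s \<in> param_interval H B" for s
  proof -
    let ?f = "\<lambda>t. (B * cosh (2 * H * t) - 1) / sqrt (1 + B\<^sup>2 - 2 * B * cosh (2 * H * t))"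
    have sub: "{min 0 s..max 0 s} \<subseteq> param_interval H B"
      using closed_segment_subset[OF zero_in_param_interval[OF assms(2)] s convex_param_interval[OF assms(1)]]
      by (simp add: closed_segment_eq_real_ivl min_def max_def split: if_splits)
    have "(LBINT t=ereal 0..ereal s. complex_of_real (?f t)) = F (of_real s) - F (of_real 0)"
    proof (rule interval_integral_FTC_finite[where F = "\<lambda>t. F (of_real t)"])
      show "continuous_on {min 0 s..max 0 s} (\<lambda>t. complex_of_real (?f t))"
        using sub by (intro continuous_intros) (force simp: param_interval_def)
      fix x assume "min 0 s \<le> x" "x \<le> max 0 s"
      then have x: "x \<in> param_interval H B" using sub by auto
      then have "((\<lambda>t. F (of_real t)) has_vector_derivative profile_dx H B (of_real x)) (at x)"
        by (intro has_vector_derivative_real_field F) (simp add: profile_strip_def)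
      then show "((\<lambda>t. F (of_real t)) has_vector_derivative complex_of_real (?f x))
          (at x within {min 0 s..max 0 s})"
        unfolding profile_dx_of_real[OF x] by (rule has_vector_derivative_at_within)
    qed
    then show ?thesis
      unfolding interval_lebesgue_integral_of_real by (simp add: F_def profile_x_def)
  qed
  with F show ?thesis by (rule that)
qed

text \<open>
  The shifted primitive and the primitive have the same derivative, so they differ by a constant
  \<open>T\<close>, which is the integral of \<open>x'\<close> from \<open>0\<close> to \<open>i\<pi>/H\<close>. Folding this segment at its
  midpoint pairs antipodal angles, and the sum of the two integrands is negative
  except at the end points.
\<close>

lemma profile_primitive_quasiperiodic:
  assumes "H > 0" "B > 0" "B \<noteq> 1"
    and F: "\<And>w. w \<in> profile_strip H B \<Longrightarrow> (F has_field_derivative profile_dx H B w) (at w)"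
  obtains T where "T \<noteq> 0"
    and "\<And>w n. w \<in> profile_strip H B \<Longrightarrow>
      F (w + of_nat n * (\<i> * of_real (pi / H))) = F w + of_nat n * T"
proof -
  let ?W = "profile_strip H B" and ?p = "\<i> * complex_of_real (pi / H)"
  have shift_in: "w + of_nat n * ?p \<in> ?W \<longleftrightarrow> w \<in> ?W" for w n
    by (simp add: profile_strip_def)
  have shift1: "w + ?p \<in> ?W \<longleftrightarrow> w \<in> ?W" for w
    using shift_in[of w 1] by simp
  have zero: "0 \<in> ?W" and im: "\<i> * of_real t \<in> ?W" for t
    using zero_in_param_interval[OF assms(3)] by (simp_all add: profile_strip_def)
  define T where "T = F ?p - F 0"
  have step: "F (w + ?p) = F w + T" if w: "w \<in> ?W" for w
  proof -
    have "\<exists>c. \<forall>w\<in>?W. F (w + ?p) - F w = c"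
    proof (rule has_field_derivative_zero_constant[OF convex_profile_strip[OF assms(2)]])
      fix w assume w: "w \<in> ?W"
      have "profile_dx H B (w + ?p) = profile_dx H B w"
        using cosh_period[of H w 1] assms(1) by (simp add: profile_dx_def radicand_def)
      moreover have "((\<lambda>w. F (w + ?p) - F w) has_field_derivative
          profile_dx H B (w + ?p) * 1 - profile_dx H B w) (at w)"
        using w shift1[of w]
        by (intro DERIV_diff F DERIV_chain2[of F, OF F]) (auto intro!: derivative_eq_intros)
      ultimately show "((\<lambda>w. F (w + ?p) - F w) has_field_derivative 0) (at w within ?W)"
        by (simp add: has_field_derivative_at_within)
    qed
    then have "F (w + ?p) - F w = F (0 + ?p) - F 0" using w zero by metis
    then show ?thesis by (simp add: T_def algebra_simps)
  qed
  have steps: "F (w + of_nat n * ?p) = F w + of_nat n * T" if w: "w \<in> ?W" for w n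
  proof (induction n)
    case (Suc n)
    have "F (w + of_nat (Suc n) * ?p) = F ((w + of_nat n * ?p) + ?p)"
      by (simp only: of_nat_Suc distrib_right mult_1_left add.assoc add.commute add.left_commute)
    also have "\<dots> = F (w + of_nat n * ?p) + T"
      using shift_in[of w n] w by (intro step) simp
    finally show ?case using Suc by (simp add: algebra_simps)
  qed simp
  have "T \<noteq> 0"
  proof -
    let ?g = "\<lambda>c. (B * c - 1) / sqrt (1 + B\<^sup>2 - 2 * B * c)"
    let ?h = "pi / (2 * H)"
    define \<phi> where "\<phi> t = Im (F (\<i> * of_real t))" for t
    have \<phi>: "(\<phi> has_real_derivative ?g (cos (2 * H * t))) (at t)" for t
    proof -
      have "((\<lambda>z. F (\<i> * z)) has_field_derivative profile_dx H B (\<i> * of_real t) * \<i>) (at (of_real t))"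
        by (rule DERIV_chain2, rule F[OF im]) (auto intro!: derivative_eq_intros)
      then have "((\<lambda>t. F (\<i> * of_real t)) has_vector_derivative profile_dx H B (\<i> * of_real t) * \<i>) (at t)"
        by (rule has_vector_derivative_real_field)
      from bounded_linear.has_vector_derivative[OF bounded_linear_Im this]
      show ?thesis
        unfolding profile_dx_imaginary[OF assms(2,3)] \<phi>_def
        by (simp add: has_real_derivative_iff_has_vector_derivative)
    qed
    \<comment> \<open>The folded primitive: its increment over half a period is that of \<open>\<phi>\<close> over a full one.\<close>
    define \<psi> where "\<psi> t = \<phi> t + \<phi> (t + ?h)" for t
    have \<psi>: "(\<psi> has_real_derivative ?g (cos (2 * H * t)) + ?g (- cos (2 * H * t))) (at t)" for t
    proof -
      have "cos (2 * H * (t + ?h)) = - cos (2 * H * t)"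
        using assms(1) by (simp add: distrib_left)
      then have "((\<lambda>t. \<phi> (t + ?h)) has_real_derivative ?g (- cos (2 * H * t)) * 1) (at t)"
        using \<phi>[of "t + ?h"] by (intro DERIV_chain2[of \<phi>]) (auto intro!: derivative_eq_intros)
      then show ?thesis
        unfolding \<psi>_def using \<phi>[of t] by (auto intro!: DERIV_add)
    qed
    have "\<psi> ?h < \<psi> 0"
    proof (rule DERIV_neg_imp_decreasing_open[where f = \<psi>])
      show "0 < ?h" using assms by simp
      show "continuous_on {0..?h} \<psi>"
        by (rule DERIV_continuous_on[OF has_field_derivative_at_within[OF \<psi>]])
      fix t assume t: "0 < t" "t < ?h"
      then have "0 < 2 * H * t" "2 * H * t < pi" using assms by (auto simp: field_simps)
      then have "0 < sin (2 * H * t)" by (rule sin_gt_zero)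
      then have "(cos (2 * H * t))\<^sup>2 < 1" by (simp add: cos_squared_eq)
      then have "\<bar>cos (2 * H * t)\<bar> < 1" by (simp add: abs_square_less_1)
      from antipodal_profile_dx_sum_neg[OF assms(2,3) this]
      show "\<exists>y. (\<psi> has_real_derivative y) (at t) \<and> y < 0" using \<psi> by blast
    qed
    then have "\<phi> (pi / H) < \<phi> 0" by (simp add: \<psi>_def field_simps)
    then show ?thesis by (auto simp: \<phi>_def T_def)
  qed
  then show ?thesis using steps that by blast
qed

section \<open>Polynomials in three variables and sections of the surface\<close>

lemma eval3_as_sum:
  "eval3 P p = (\<Sum>k\<le>degree P. poly (poly (coeff P k) [:p $ 2:]) (p $ 1) * (p $ 3) ^ k)"
proof -
  have "poly P [:[:p $ 3:]:] = (\<Sum>k\<le>degree P. coeff P k * [:[:p $ 3:]:] ^ k)"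
    by (rule poly_altdef)
  then show ?thesis by (simp add: eval3_def poly_sum poly_power)
qed

text \<open>
  The coefficients of \<open>P\<close> are polynomials in \<open>y\<close> over the integral domain \<open>\<real>[x]\<close>, and the
  constants \<open>[:y:]\<close> are infinitely many points of that domain.
\<close>

lemma poly_eq_0_if_coeff_sections_eq_0:
  fixes P :: poly3
  assumes "\<And>y k. poly (coeff P k) [:y:] = 0"
  shows "P = 0"
proof -
  have "coeff P k = 0" for k
  proof (rule ccontr)
    assume "coeff P k \<noteq> 0"
    then have "finite {x. poly (coeff P k) x = 0}" by (rule poly_roots_finite)
    moreover have "range (\<lambda>y. [:y:]) \<subseteq> {x. poly (coeff P k) x = 0}" using assms by auto
    ultimately have "finite (range (\<lambda>y::real. [:y:]))" by (rule rev_finite_subset)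
    then have "finite (UNIV :: real set)" by (rule finite_imageD) (auto intro: injI)
    then show False using infinite_UNIV_char_0 by blast
  qed
  then show ?thesis by (simp add: poly_eq_iff)
qed

lemma profile_z_squared:
  assumes "s \<in> param_interval H B"
  shows "(profile_z H B s)\<^sup>2 = (1 + B\<^sup>2 - 2 * B * cosh (2 * H * s)) / (2 * H)\<^sup>2"
  using assms by (simp add: profile_z_def param_interval_def power_mult_distrib power_divide)

text \<open>
  Solving \<open>z(s) sinh \<theta> = y\<close> for the angle reaches every \<open>y\<close>, so the plane section is
  parametrized by all of the parameter interval.
\<close>

lemma section_point_in_surface:
  assumes "H > 0" "s \<in> param_interval H B"
  shows "vector [profile_x H B s, y, sqrt ((profile_z H B s)\<^sup>2 + y\<^sup>2)] \<in> cmc_revolution_surface H B"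
proof -
  let ?z = "profile_z H B s"
  have z: "?z > 0" using assms by (simp add: profile_z_def param_interval_def)
  have "?z * cosh (arsinh (y / ?z)) = ?z * sqrt ((y / ?z)\<^sup>2 + 1)"
    by (simp add: cosh_arsinh_real)
  also have "\<dots> = sqrt (?z\<^sup>2 * ((y / ?z)\<^sup>2 + 1))"
    using z by (simp add: real_sqrt_mult)
  also have "?z\<^sup>2 * ((y / ?z)\<^sup>2 + 1) = ?z\<^sup>2 + y\<^sup>2"
    using z by (simp add: field_simps)
  finally have "revolution_param H B s (arsinh (y / ?z)) =
      vector [profile_x H B s, y, sqrt (?z\<^sup>2 + y\<^sup>2)]"
    using z by (simp add: revolution_param_def)
  then show ?thesis
    unfolding cmc_revolution_surface_def using assms(2) by (metis (mono_tags, lifting) CollectI)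
qed

theorem theorem3p4:
  fixes H B :: real
  assumes "H > 0" and "B \<in> {0<..} - {1}"
  shows "\<not> algebraic_surface (cmc_revolution_surface H B)"
proof
  assume "algebraic_surface (cmc_revolution_surface H B)"
  then obtain P :: poly3 where P: "P \<noteq> 0"
    and van: "\<And>p. p \<in> cmc_revolution_surface H B \<Longrightarrow> eval3 P p = 0"
    by (auto simp: algebraic_surface_def)
  have B: "B > 0" "B \<noteq> 1" using assms by auto
  let ?W = "profile_strip H B" and ?I = "param_interval H B"
  obtain F where F: "\<And>w. w \<in> ?W \<Longrightarrow> (F has_field_derivative profile_dx H B w) (at w)"
    and Fx: "\<And>s. s \<in> ?I \<Longrightarrow> F (of_real s) = of_real (profile_x H B s)"
    using profile_x_extends_to_strip[OF B, of H] by blast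
  obtain T where T: "T \<noteq> 0" and shift: "\<And>w n. w \<in> ?W \<Longrightarrow>
      F (w + of_nat n * (\<i> * of_real (pi / H))) = F w + of_nat n * T"
    using profile_primitive_quasiperiodic[OF assms(1) B, of F] F by blast
  have F_holo: "F holomorphic_on ?W"
    using F open_profile_strip by (auto simp: holomorphic_on_open)
  have "poly (coeff P k) [:y:] = 0" for y k
  proof -
    \<comment> \<open>\<open>q k\<close> is the coefficient of \<open>z\<^sup>k\<close> on the section, a polynomial in \<open>x\<close>; \<open>r\<close> and its
      continuation \<open>\<zeta>\<close> are the last coordinate, and \<open>\<Phi>\<close> is \<open>P\<close> along the continued section.\<close>
    define q where "q k = poly (coeff P k) [:y:]" for k
    define r where "r s = sqrt ((profile_z H B s)\<^sup>2 + y\<^sup>2)" for s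
    define \<zeta> where "\<zeta> w = csqrt (radicand H B w / of_real ((2 * H)\<^sup>2) + of_real (y\<^sup>2))" for w
    define \<Phi> where "\<Phi> w = (\<Sum>k\<le>degree P. (\<Sum>i\<le>degree (q k). of_real (coeff (q k) i) * F w ^ i) * \<zeta> w ^ k)" for w
    have \<zeta>r: "\<zeta> (of_real s) = of_real (r s)" if "s \<in> ?I" for s
    proof -
      let ?D = "1 + B\<^sup>2 - 2 * B * cosh (2 * H * s)"
      have D: "?D > 0" using that by (simp add: param_interval_def)
      have "?D / (2 * H)\<^sup>2 + y\<^sup>2 > 0"
        using D assms(1) by (intro add_pos_nonneg divide_pos_pos) auto
      then show ?thesis
        unfolding \<zeta>_def r_def profile_z_squared[OF that] radicand_of_real of_real_divide[symmetric] of_real_add[symmetric]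
        by (simp only: csqrt_of_real_pos)
    qed
    have "\<zeta> holomorphic_on ?W"
    proof -
      have "Re (radicand H B w / of_real ((2 * H)\<^sup>2) + of_real (y\<^sup>2)) > 0" if "w \<in> ?W" for w
        using Re_radicand_pos[OF B(1) that] assms(1)
        by (simp add: Re_divide_of_real add_pos_nonneg del: of_real_power of_real_mult)
      then show ?thesis
        unfolding \<zeta>_def using assms(1)
        by (intro holomorphic_on_csqrt' not_nonpos_Reals_if_Re_pos)
           (auto intro!: holomorphic_intros radicand_holomorphic)
    qed
    then have \<Phi>_holo: "\<Phi> holomorphic_on ?W"
      unfolding \<Phi>_def using F_holo by (intro holomorphic_intros)
    have \<Phi>_real: "\<Phi> w = 0" if w: "w \<in> of_real ` ?I" for w
    proof -
      obtain s where s: "s \<in> ?I" "w = of_real s" using w by auto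
      have "\<Phi> w = of_real (eval3 P (vector [profile_x H B s, y, r s]))"
        by (simp add: \<Phi>_def s Fx \<zeta>r eval3_as_sum q_def poly_altdef[of "poly _ _"])
      also have "\<dots> = 0" using van[OF section_point_in_surface[OF assms(1) s(1), of y]] by (simp add: r_def)
      finally show ?thesis .
    qed
    have \<Phi>_zero: "\<Phi> w = 0" if "w \<in> ?W" for w
    proof (rule analytic_continuation[OF \<Phi>_holo open_profile_strip])
      show "connected ?W" by (rule convex_connected[OF convex_profile_strip[OF B(1)]])
      show "of_real ` ?I \<subseteq> ?W" by (auto simp: profile_strip_def)
      show "(0::complex) \<in> ?W" using zero_in_param_interval[OF B(2)] by (simp add: profile_strip_def)
      have "(0::real) islimpt ?I"
        by (rule interior_limit_point) (simp add: interior_open open_param_interval zero_in_param_interval[OF B(2)])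
      then show "(0::complex) islimpt of_real ` ?I"
        using islimpt_isCont_image[of 0 ?I complex_of_real] by (auto simp: eventually_at_filter)
    qed (use that \<Phi>_real in auto)
    have coeff_zero: "(\<Sum>k\<le>degree P. coeff (q k) i * r s ^ k) = 0" if s: "s \<in> ?I" for i s
    proof -
      \<comment> \<open>\<open>R\<close> is \<open>P\<close> as a polynomial in \<open>x\<close> above the height \<open>r s\<close>; moving by imaginary periods
        changes only the argument of \<open>R\<close>.\<close>
      define R where "R = (\<Sum>k\<le>degree P. smult (of_real (r s) ^ k) (map_poly complex_of_real (q k)))"
      have "poly R (F (of_real s) + of_nat n * T) = 0" for n
      proof -
        let ?w = "of_real s + of_nat n * (\<i> * complex_of_real (pi / H))"
        have w: "of_real s \<in> ?W" "?w \<in> ?W" using s by (simp_all add: profile_strip_def)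
        have "\<zeta> ?w = of_real (r s)"
          unfolding \<zeta>r[OF s, symmetric] unfolding \<zeta>_def radicand_def
          using cosh_period[of H "of_real s" n] assms(1) by simp
        then have "\<Phi> ?w = poly R (F (of_real s) + of_nat n * T)"
          unfolding \<Phi>_def R_def shift[OF w(1)]
          by (simp add: poly_sum poly_altdef[of "map_poly _ _"] coeff_map_poly degree_map_poly mult.commute)
        then show ?thesis using \<Phi>_zero[OF w(2)] by simp
      qed
      then have "range (\<lambda>n::nat. F (of_real s) + of_nat n * T) \<subseteq> {x. poly R x = 0}" by auto
      moreover have "infinite (range (\<lambda>n::nat. F (of_real s) + of_nat n * T))"
        by (rule range_inj_infinite) (auto intro!: injI simp: T)
      ultimately have "R = 0" using poly_roots_finite finite_subset by blast
      then have "coeff R i = 0" by simp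
      then have "complex_of_real (\<Sum>k\<le>degree P. coeff (q k) i * r s ^ k) = 0"
        by (simp add: R_def coeff_sum coeff_map_poly mult.commute)
      then show ?thesis by (simp only: of_real_eq_0_iff)
    qed
    \<comment> \<open>The height is an even function of \<open>s\<close>, so injectivity is sought on one side of \<open>0\<close>.\<close>
    have "infinite (r ` ?I)"
    proof -
      obtain e where e: "e > 0" "ball 0 e \<subseteq> ?I"
        using open_param_interval zero_in_param_interval[OF B(2)] open_contains_ball by blast
      have sub: "{0<..<e} \<subseteq> ?I" using e by (force simp: dist_real_def)
      have "inj_on r {0<..<e}"
      proof (rule inj_onI)
        fix s t assume s: "s \<in> {0<..<e}" and t: "t \<in> {0<..<e}" and "r s = r t"
        then have "(profile_z H B s)\<^sup>2 = (profile_z H B t)\<^sup>2" by (simp add: r_def)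
        moreover have "s \<in> ?I" "t \<in> ?I" using s t sub by auto
        ultimately have "cosh (2 * H * s) = cosh (2 * H * t)"
          using B assms(1) by (simp add: profile_z_squared)
        then show "s = t" using s t assms(1) by simp
      qed
      then have "infinite (r ` {0<..<e})"
        using e(1) by (simp add: finite_image_iff)
      then show ?thesis using sub by (meson finite_subset image_mono)
    qed
    have "coeff (q k) i = 0" if "k \<le> degree P" for k i
    proof -
      \<comment> \<open>For fixed \<open>i\<close> the identity just obtained is polynomial in the height, which takes
        infinitely many values.\<close>
      define S where "S = (\<Sum>k\<le>degree P. monom (coeff (q k) i) k)"
      have "r ` ?I \<subseteq> {x. poly S x = 0}"
        using coeff_zero by (auto simp: S_def poly_sum poly_monom)
      then have "S = 0" using \<open>infinite (r ` ?I)\<close> poly_roots_finite finite_subset by blast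
      then have "coeff S k = 0" by simp
      then show ?thesis using that by (simp add: S_def coeff_sum)
    qed
    then show ?thesis
      by (cases "k \<le> degree P") (auto simp: q_def poly_eq_iff coeff_eq_0)
  qed
  then show False using P poly_eq_0_if_coeff_sections_eq_0 by blast
qed

end
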